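(* Let $\mathcal X=X_1\coprod X_2$ be a geometric $M$-poset with $\mathcal R=[2]=\{1<2\}$, considered with the Up topology. Let $A\subseteq X_1$, let $Z$ be a topological space, and let $s:Z\to A$ and $s':Z\to\uparrow A$ be continuous maps such that $s'$ lies over $s$, i.e. $s(z)\le s'(z)$ for every $z\in Z$. Put $C:=(s')^{-1}(A)$. Then, as maps $Z\to\uparrow A$, $s'$ and $s$ are homotopic rel $C$.
   Context: A topological poset is a poset $(\mathcal X,\le)$ with a Hausdorff topology on $\mathcal X$ (the Original topology) such that the order relation $\mathcal P=\{(x,y)\mid x\le y\}$ is closed in $\mathcal X\times\mathcal X$. An $M$-poset is a topological poset with a poset map (mirror) $\mu:\mathcal X\to\mathcal R$ to a finite poset $\mathcal R$ such that $x<y$ implies $\mu(x)<\mu(y)$, and every $X_r=\mu^{-1}(r)$ is a non-empty closed subset of $\mathcal X$ (so $\mathcal X$ is the topological sum of the $X_r$). For $A\subseteq\mathcal X$ let $\uparrow A=\{x\in\mathcal X\mid a\le x\text{ for some }a\in A\}$; for $A\subseteq X_r$ (or a point) let $A^{(s)}=(\uparrow A)\cap X_s$. Standing assumption (Openness Property) on all $M$-posets: if $U$ is open in $X_r$ then $\uparrow U$ is open in $\mathcal X$ (Original topology). A polyhedron is a locally compact space with a PL structure, i.e. identified with a locally finite, finite-dimensional rectilinear simplicial complex properly embedded as a closed subset of a Euclidean space, up to common rectilinear subdivision; it carries a length metric from a triangulation. A subpolyhedron is a closed subset triangulated by a subcomplex of some triangulation in the PL structure. An $M$-poset is polyhedral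 if each $X_r$ is a polyhedron and $\mathcal P$ is a subpolyhedron of $\mathcal X\times\mathcal X$. For each $r$, $\mathcal U_r$ is a basis for the topology of $X_r$ consisting of interiors of compact neighborhoods that are PL cones on their frontiers. The Up topology on $\mathcal X$ has basis $\{\uparrow U\mid U\in\mathcal U_r,\ r\in\mathcal R\}$; subsets such as $\uparrow A$ and $A$ carry the subspace topology from the Up topology (on each $X_r$ this agrees with the Original topology). A compact subset $C$ of a polyhedron $D$ has trivial shape if $C$ (non-empty) can be contracted to a point in each of its neighborhoods in $D$. $cM$ is the space of non-empty compact subsets of a metric space $M$ with the Hausdorff metric. A polyhedral $M$-poset is geometric if for all $r<s$ in $\mathcal R$: (A1) for $x\in X_r$ the set $x^{(s)}$ is compact and non-empty; (A2) the map $X_r\to cX_s$, $x\mapsto x^{(s)}$, is continuous; (A3) if $U\in\mathcal U_r$ and $y\in\overline U^{(s)}$, then $\{x\in\overline U\mid x<y\}$ has trivial shape. *)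

theory Defs
  imports "HOL-Analysis.Analysis"
begin

section \<open>Polyhedra\<close>

text \<open>Finite-dimensionality is automatic in a Euclidean space. As for the library's
  \<^const>\<open>simplicial_complex\<close>, which is the finite case, the empty set may occur as
  a simplex.\<close>

definition rectilinear_complex :: "'e::euclidean_space set set \<Rightarrow> bool" where
  "rectilinear_complex K \<longleftrightarrow>
     (\<forall>S\<in>K. \<exists>n. n simplex S) \<and>
     (\<forall>S\<in>K. \<forall>F. F face_of S \<longrightarrow> F \<in> K) \<and>
     (\<forall>S\<in>K. \<forall>S'\<in>K. (S \<inter> S') face_of S) \<and>
     locally_finite_in (top_of_set (\<Union>K)) K \<and>
     closed (\<Union>K)"

text \<open>The triangulations \<open>K\<close> of a given closed set with \<open>\<Union>K = D\<close> all have common rectilinear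
  subdivisions, so the set \<open>D\<close> alone determines the PL structure.\<close>

definition euclidean_polyhedron :: "'e::euclidean_space set \<Rightarrow> bool" where
  "euclidean_polyhedron D \<longleftrightarrow> (\<exists>K. rectilinear_complex K \<and> \<Union>K = D)"

definition subpolyhedron :: "'e::euclidean_space set \<Rightarrow> 'e set \<Rightarrow> bool" where
  "subpolyhedron B D \<longleftrightarrow>
     (\<exists>K L. rectilinear_complex K \<and> \<Union>K = D \<and> rectilinear_complex L \<and> L \<subseteq> K \<and> \<Union>L = B)"

text \<open>A PL structure on an abstract space is given by an identification \<open>e\<close> with a polyhedron
  in a Euclidean space.\<close>

definition polyhedron_chart :: "'a topology \<Rightarrow> ('a \<Rightarrow> 'e::euclidean_space) \<Rightarrow> bool" where
  "polyhedron_chart X e \<longleftrightarrow>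
     embedding_map X euclidean e \<and> euclidean_polyhedron (e ` topspace X)"

definition pl_map_on :: "'e::euclidean_space set \<Rightarrow> ('e \<Rightarrow> 'f::euclidean_space) \<Rightarrow> bool" where
  "pl_map_on D f \<longleftrightarrow>
     (\<exists>K. rectilinear_complex K \<and> \<Union>K = D \<and>
          (\<forall>S\<in>K. \<exists>g c. linear g \<and> (\<forall>x\<in>S. f x = g x + c)))"

text \<open>The cone with base \<open>F \<times> {0}\<close> and apex \<open>(0,1)\<close>; the cone on the empty set is the apex.\<close>

definition cone_over :: "'e::euclidean_space set \<Rightarrow> ('e \<times> real) set" where
  "cone_over F = insert (0, 1) (\<Union>x\<in>F. closed_segment (x, 0) (0, 1))"

definition pl_cone_on :: "'e::euclidean_space set \<Rightarrow> 'e set \<Rightarrow> bool" where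
  "pl_cone_on N F \<longleftrightarrow>
     (\<exists>h k. homeomorphism (cone_over F) N h k \<and> pl_map_on (cone_over F) h \<and>
            (\<forall>x\<in>F. h (x, 0) = x))"

text \<open>Length metric of a polyhedron \<open>D\<close>: the infimum of the lengths of polygonal paths in \<open>D\<close>, the
  simplices of any rectilinear triangulation carrying their Euclidean metric. It is \<open>\<infinity>\<close>
  between points of different components of \<open>D\<close>.\<close>

definition length_dist :: "'e::euclidean_space set \<Rightarrow> 'e \<Rightarrow> 'e \<Rightarrow> ennreal" where
  "length_dist D x y =
     (INF xs \<in> {xs. xs \<noteq> [] \<and> hd xs = x \<and> last xs = y \<and>
                    (\<forall>i. Suc i < length xs \<longrightarrow> closed_segment (xs ! i) (xs ! Suc i) \<subseteq> D)}.
        ennreal (\<Sum>i<length xs - 1. dist (xs ! i) (xs ! Suc i)))"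

definition hausdorff_dist :: "('b \<Rightarrow> 'b \<Rightarrow> ennreal) \<Rightarrow> 'b set \<Rightarrow> 'b set \<Rightarrow> ennreal" where
  "hausdorff_dist d A B =
     max (SUP a\<in>A. INF b\<in>B. d a b) (SUP b\<in>B. INF a\<in>A. d a b)"

definition compact_subsets :: "'e::euclidean_space set \<Rightarrow> 'e set set" where
  "compact_subsets D = {A. A \<subseteq> D \<and> A \<noteq> {} \<and> compact A}"

text \<open>The space \<open>cD\<close> of non-empty compact subsets of \<open>D\<close>, with the topology of the
  Hausdorff metric.\<close>

definition compact_hyperspace :: "'e::euclidean_space set \<Rightarrow> 'e set topology" where
  "compact_hyperspace D = topology (\<lambda>W. W \<subseteq> compact_subsets D \<and>
     (\<forall>A\<in>W. \<exists>\<epsilon>>0. \<forall>B\<in>compact_subsets D. hausdorff_dist (length_dist D) A B < \<epsilon> \<longrightarrow> B \<in> W))"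

lemma openin_compact_hyperspace:
  "openin (compact_hyperspace D) W \<longleftrightarrow> W \<subseteq> compact_subsets D \<and>
     (\<forall>A\<in>W. \<exists>\<epsilon>>0. \<forall>B\<in>compact_subsets D. hausdorff_dist (length_dist D) A B < \<epsilon> \<longrightarrow> B \<in> W)"
proof -
  define near where
    "near A \<epsilon> B \<longleftrightarrow> B \<in> compact_subsets D \<and> hausdorff_dist (length_dist D) A B < \<epsilon>" for A B and \<epsilon> :: ennreal
  define op where
    "op W \<longleftrightarrow> W \<subseteq> compact_subsets D \<and> (\<forall>A\<in>W. \<exists>\<epsilon>>0. \<forall>B. near A \<epsilon> B \<longrightarrow> B \<in> W)" for W
  have op_eq: "op \<equiv> (\<lambda>W. W \<subseteq> compact_subsets D \<and>
     (\<forall>A\<in>W. \<exists>\<epsilon>>0. \<forall>B\<in>compact_subsets D. hausdorff_dist (length_dist D) A B < \<epsilon> \<longrightarrow> B \<in> W))"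
    unfolding op_def near_def Ball_def imp_conjL by (rule reflexive)
  have "op (V \<inter> W)" if V: "op V" and W: "op W" for V W
    unfolding op_def
  proof (intro conjI ballI)
    show "V \<inter> W \<subseteq> compact_subsets D" using V unfolding op_def by blast
  next
    fix A assume A: "A \<in> V \<inter> W"
    obtain a where a: "a > 0" "\<And>B. near A a B \<Longrightarrow> B \<in> V" using V A unfolding op_def by blast
    obtain b where b: "b > 0" "\<And>B. near A b B \<Longrightarrow> B \<in> W" using W A unfolding op_def by blast
    have "near A (min a b) B \<Longrightarrow> near A a B \<and> near A b B" for B by (simp add: near_def)
    then show "\<exists>\<epsilon>>0. \<forall>B. near A \<epsilon> B \<longrightarrow> B \<in> V \<inter> W"
      using a b by (intro exI[of _ "min a b"]) auto
  qed
  moreover have "op (\<Union>\<W>)" if ops: "\<forall>W\<in>\<W>. op W" for \<W>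
    unfolding op_def
  proof (intro conjI ballI)
    show "\<Union>\<W> \<subseteq> compact_subsets D" using ops unfolding op_def by blast
  next
    fix A assume "A \<in> \<Union>\<W>"
    then obtain W where W: "W \<in> \<W>" "A \<in> W" by blast
    then obtain a where "a > 0" "\<And>B. near A a B \<Longrightarrow> B \<in> W" using ops unfolding op_def by blast
    then show "\<exists>\<epsilon>>0. \<forall>B. near A \<epsilon> B \<longrightarrow> B \<in> \<Union>\<W>" using W by blast
  qed
  ultimately have "istopology op"
    unfolding istopology_def by simp
  then have "openin (topology op) W \<longleftrightarrow> op W"
    by simp
  then show ?thesis
    unfolding compact_hyperspace_def op_eq .
qed

definition trivial_shape :: "'a topology \<Rightarrow> 'a set \<Rightarrow> bool" where
  "trivial_shape X C \<longleftrightarrow> compactin X C \<and> C \<noteq> {} \<and>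
     (\<forall>N. N \<subseteq> topspace X \<and> C \<subseteq> X interior_of N \<longrightarrow>
        (\<exists>c. homotopic_with (\<lambda>h. True) (subtopology X C) (subtopology X N) id (\<lambda>x. c)))"


section \<open>Topological posets and M-posets\<close>

text \<open>The underlying set is \<^term>\<open>topspace T\<close>, where \<open>T\<close> is the Original topology, and
  \<open>(x, y) \<in> P\<close> means \<open>x \<le> y\<close>. Thus \<open>\<up>A\<close> is the relational image \<^term>\<open>P `` A\<close>.\<close>

locale topological_poset =
  fixes T :: "'a topology" and P :: "('a \<times> 'a) set"
  assumes Hausdorff: "Hausdorff_space T"
    and partial_order: "partial_order_on (topspace T) P"
    and closed_order: "closedin (prod_topology T T) P"

definition stratum :: "'a topology \<Rightarrow> ('a \<Rightarrow> 'r) \<Rightarrow> 'r \<Rightarrow> 'a set" where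
  "stratum T \<mu> r = {x \<in> topspace T. \<mu> x = r}"

definition stratum_space :: "'a topology \<Rightarrow> ('a \<Rightarrow> 'r) \<Rightarrow> 'r \<Rightarrow> 'a topology" where
  "stratum_space T \<mu> r = subtopology T (stratum T \<mu> r)"

text \<open>\<open>up_part T P \<mu> A s\<close> is \<open>A\<^sup>(\<^sup>s\<^sup>)\<close>.\<close>

definition up_part ::
  "'a topology \<Rightarrow> ('a \<times> 'a) set \<Rightarrow> ('a \<Rightarrow> 'r) \<Rightarrow> 'a set \<Rightarrow> 'r \<Rightarrow> 'a set" where
  "up_part T P \<mu> A s = P `` A \<inter> stratum T \<mu> s"

locale m_poset = topological_poset T P
  for T :: "'a topology" and P :: "('a \<times> 'a) set" +
  fixes R :: "'r::order set" and \<mu> :: "'a \<Rightarrow> 'r"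
  assumes finite_R: "finite R"
    and mirror: "\<mu> \<in> topspace T \<rightarrow> R"
    and mirror_strict: "\<lbrakk>(x, y) \<in> P; x \<noteq> y\<rbrakk> \<Longrightarrow> \<mu> x < \<mu> y"
    and stratum_nonempty: "r \<in> R \<Longrightarrow> stratum T \<mu> r \<noteq> {}"
    and stratum_closed: "r \<in> R \<Longrightarrow> closedin T (stratum T \<mu> r)"
    and openness: "\<lbrakk>r \<in> R; openin (stratum_space T \<mu> r) U\<rbrakk> \<Longrightarrow> openin T (P `` U)"

text \<open>\<open>e r\<close> is the PL structure of the stratum \<open>X\<^sub>r\<close>; a single Euclidean space \<open>'e\<close> is no
  restriction, since \<open>R\<close> is finite. As \<open>X \<times> X\<close> is the topological sum of the
  \<open>X\<^sub>r \<times> X\<^sub>s\<close>, being a subpolyhedron of \<open>X \<times> X\<close> is a condition on each summand.\<close>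

locale polyhedral_m_poset = m_poset T P R \<mu>
  for T :: "'a topology" and P :: "('a \<times> 'a) set"
    and R :: "'r::order set" and \<mu> :: "'a \<Rightarrow> 'r" +
  fixes e :: "'r \<Rightarrow> 'a \<Rightarrow> 'e::euclidean_space"
    and \<U> :: "'r \<Rightarrow> 'a set set"
  assumes chart: "r \<in> R \<Longrightarrow> polyhedron_chart (stratum_space T \<mu> r) (e r)"
    and order_subpolyhedron: "\<lbrakk>r \<in> R; s \<in> R\<rbrakk> \<Longrightarrow>
      subpolyhedron ((\<lambda>(x, y). (e r x, e s y)) ` (P \<inter> stratum T \<mu> r \<times> stratum T \<mu> s))
        (e r ` stratum T \<mu> r \<times> e s ` stratum T \<mu> s)"
    and basis: "r \<in> R \<Longrightarrow>
      openin (stratum_space T \<mu> r) = arbitrary union_of (\<lambda>U. U \<in> \<U> r)"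
    and basis_cones: "\<lbrakk>r \<in> R; U \<in> \<U> r\<rbrakk> \<Longrightarrow>
      \<exists>N. compactin (stratum_space T \<mu> r) N \<and>
          U = stratum_space T \<mu> r interior_of N \<and> U \<noteq> {} \<and>
          pl_cone_on (e r ` N) (e r ` (stratum_space T \<mu> r frontier_of N))"

text \<open>By the Openness Property the generating sets form a basis.\<close>

definition up_topology :: "('a \<times> 'a) set \<Rightarrow> 'r set \<Rightarrow> ('r \<Rightarrow> 'a set set) \<Rightarrow> 'a topology" where
  "up_topology P R \<U> = topology_generated_by {P `` U | r U. r \<in> R \<and> U \<in> \<U> r}"

locale geometric_m_poset = polyhedral_m_poset T P R \<mu> e \<U>
  for T :: "'a topology" and P :: "('a \<times> 'a) set"
    and R :: "'r::order set" and \<mu> :: "'a \<Rightarrow> 'r"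
    and e :: "'r \<Rightarrow> 'a \<Rightarrow> 'e::euclidean_space"
    and \<U> :: "'r \<Rightarrow> 'a set set" +
  assumes A1: "\<lbrakk>r \<in> R; s \<in> R; r < s; x \<in> stratum T \<mu> r\<rbrakk> \<Longrightarrow>
      compactin (stratum_space T \<mu> s) (up_part T P \<mu> {x} s) \<and> up_part T P \<mu> {x} s \<noteq> {}"
    and A2: "\<lbrakk>r \<in> R; s \<in> R; r < s\<rbrakk> \<Longrightarrow>
      continuous_map (stratum_space T \<mu> r) (compact_hyperspace (e s ` stratum T \<mu> s))
        (\<lambda>x. e s ` up_part T P \<mu> {x} s)"
    and A3: "\<lbrakk>r \<in> R; s \<in> R; r < s; U \<in> \<U> r;
        y \<in> up_part T P \<mu> (stratum_space T \<mu> r closure_of U) s\<rbrakk> \<Longrightarrow>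
      trivial_shape (stratum_space T \<mu> r)
        {x \<in> stratum_space T \<mu> r closure_of U. (x, y) \<in> P \<and> x \<noteq> y}"

end

theory Submission
  imports Defs
begin

text \<open>Every open set of the Up topology is an up-set. If \<open>s \<le> s'\<close> pointwise, the map which is
  \<open>s'\<close> at all times \<open>t < 1\<close> and jumps to \<open>s\<close> at \<open>t = 1\<close> is therefore already continuous: the
  preimage of an open set \<open>W\<close> is \<open>[0,1] \<times> s\<^sup>-\<^sup>1(W) \<union> [0,1) \<times> s'\<^sup>-\<^sup>1(W)\<close>. Where \<open>s'\<close> takes values in
  \<open>A\<close>, both points lie in the same stratum, hence coincide.\<close>

lemma openin_up_topology_upset:
  assumes "trans P" "openin (up_topology P R \<U>) W" "x \<in> W" "(x, y) \<in> P"
  shows "y \<in> W"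
proof -
  have "generate_topology_on {P `` U | r U. r \<in> R \<and> U \<in> \<U> r} W"
    using assms(2) unfolding up_topology_def openin_topology_generated_by_iff .
  then have "x \<in> W \<longrightarrow> (x, y) \<in> P \<longrightarrow> y \<in> W"
  proof induction
    case (Basis B)
    then show ?case using transD[OF assms(1)] by blast
  qed blast+
  then show ?thesis using assms(3,4) by blast
qed

text \<open>The order enters only through \<open>upset\<close>, which says that \<open>f z\<close>
  lies in the closure of the point \<open>g z\<close>.\<close>

lemma homotopic_with_if_le:
  assumes f: "continuous_map Z Y f" and g: "continuous_map Z Y g"
    and upset: "\<And>W z. \<lbrakk>openin Y W; z \<in> topspace Z; f z \<in> W\<rbrakk> \<Longrightarrow> g z \<in> W"
    and Qf: "Q f" and Qg: "Q g"
  shows "homotopic_with Q Z Y g f"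
proof -
  let ?I = "top_of_set {0..1::real}"
  let ?h = "\<lambda>(t::real, z). if t < 1 then g z else f z"
  have "continuous_map (prod_topology ?I Z) Y ?h"
    unfolding continuous_map_def
  proof (intro conjI allI impI)
    show "?h \<in> topspace (prod_topology ?I Z) \<rightarrow> topspace Y"
      using continuous_map_funspace[OF f] continuous_map_funspace[OF g] by (auto simp: Pi_iff)
  next
    fix W assume W: "openin Y W"
    let ?F = "{z \<in> topspace Z. f z \<in> W}" and ?G = "{z \<in> topspace Z. g z \<in> W}"
    \<comment> \<open>At time 1 only \<open>?F\<close> contributes. Since \<open>upset\<close> gives
      \<open>?F\<close> \<subseteq> \<open>?G\<close>, that slice can be thickened to all of
      \<open>{0..1}\<close>, which makes the preimage open.\<close>
    have "{p \<in> topspace (prod_topology ?I Z). ?h p \<in> W} = {0..1} \<times> ?F \<union> {0..<1} \<times> ?G"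
      using upset[OF W] by (auto split: if_splits)
    moreover have "openin ?I {0..<1}"
    proof -
      have "{0..<1} = {0..1} \<inter> {..<1::real}" by auto
      then show ?thesis by (metis open_lessThan openin_open)
    qed
    ultimately show "openin (prod_topology ?I Z) {p \<in> topspace (prod_topology ?I Z). ?h p \<in> W}"
      using openin_continuous_map_preimage[OF f W] openin_continuous_map_preimage[OF g W]
      by (auto intro!: openin_Un simp: openin_prod_Times_iff)
  qed
  \<comment> \<open>Every stage of the homotopy is \<open>g\<close> or \<open>f\<close>
    itself.\<close>
  moreover have "Q (\<lambda>z. ?h (t, z))" for t
    using Qf Qg by (cases "t < 1") auto
  ultimately show ?thesis
    unfolding homotopic_with_def by (intro exI[of _ ?h]) auto
qed

theorem proposition4p3:
  fixes T :: "'a topology" and P :: "('a \<times> 'a) set" and \<mu> :: "'a \<Rightarrow> nat"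
    and e :: "nat \<Rightarrow> 'a \<Rightarrow> 'e::euclidean_space" and \<U> :: "nat \<Rightarrow> 'a set set"
    and A :: "'a set" and Z :: "'z topology" and s s' :: "'z \<Rightarrow> 'a" and C :: "'z set"
  assumes "geometric_m_poset T P {1, 2} \<mu> e \<U>"
    and "A \<subseteq> stratum T \<mu> 1"
    and "continuous_map Z (subtopology (up_topology P {1, 2} \<U>) A) s"
    and "continuous_map Z (subtopology (up_topology P {1, 2} \<U>) (P `` A)) s'"
    and "\<forall>z\<in>topspace Z. (s z, s' z) \<in> P"
    and "C = {z \<in> topspace Z. s' z \<in> A}"
  shows "homotopic_with (\<lambda>h. \<forall>z\<in>C. h z = s' z)
           Z (subtopology (up_topology P {1, 2} \<U>) (P `` A)) s' s"
proof -
  let ?Y = "up_topology P {1, 2} \<U>"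
  interpret geometric_m_poset T P "{1, 2}" \<mu> e \<U> by fact
  have trans: "trans P" and refl: "\<And>x. x \<in> topspace T \<Longrightarrow> (x, x) \<in> P"
    using partial_order by (auto simp: partial_order_on_def preorder_on_def refl_on_def)
  have "A \<subseteq> P `` A"
    using assms(2) refl by (auto simp: stratum_def)
  then have s: "continuous_map Z (subtopology ?Y (P `` A)) s"
    by (metis assms(3) continuous_map_into_subtopology continuous_map_in_subtopology subset_trans
        image_subset_iff_funcset)
  have s_A: "s z \<in> A" if "z \<in> topspace Z" for z
    using assms(3) that by (auto simp: continuous_map_in_subtopology)
  show ?thesis
  proof (rule homotopic_with_if_le[OF s assms(4)])
    fix W z
    assume W: "openin (subtopology ?Y (P `` A)) W" and z: "z \<in> topspace Z" "s z \<in> W"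
    obtain V where "openin ?Y V" "W = V \<inter> P `` A"
      using W by (auto simp: openin_subtopology)
    then show "s' z \<in> W"
      using openin_up_topology_upset[OF trans] s_A z assms(5) by blast
  next
    \<comment> \<open>This makes the final stage \<open>s\<close> stationary on \<open>C\<close>;
      strictness of the mirror excludes distinct comparable points in one stratum.\<close>
    have "s z = s' z" if "z \<in> C" for z
    proof (rule ccontr)
      assume "s z \<noteq> s' z"
      then have "\<mu> (s z) < \<mu> (s' z)"
        using mirror_strict assms(5,6) that by blast
      moreover have "s z \<in> stratum T \<mu> 1" "s' z \<in> stratum T \<mu> 1"
        using s_A assms(2,6) that by auto
      ultimately show False by (simp add: stratum_def)
    qed
    then show "\<forall>z\<in>C. s z = s' z" by blast
  qed simp
qed

end
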